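(* Let $d\ge 1$ be an integer, let $C_d=\{[x:y:z]\in\mathbb{CP}^2\mid x^d+y^d+z^d=0\}$, and let $K\subseteq\mathbb{CP}^2\setminus C_d$ be the set of points $[x:y:z]$ admitting a representative $(x,y,z)$ with $x^d,y^d,z^d\in\mathbb{R}_{\ge 0}$. Let $\tilde r:M_d\times[0,1]\to M_d$ be the strong deformation retraction from $M_d$ to $S_d$ described in the context. Then $\tilde r$ induces a strong deformation retraction from $\mathbb{CP}^2\setminus C_d$ to $K$: the assignment $([p],t)\mapsto[\tilde r(p,t)]$, where $p\in M_d$ is any representative of the point $[p]\in\mathbb{CP}^2\setminus C_d$ lying in $M_d$, is a well-defined strong deformation retraction from $\mathbb{CP}^2\setminus C_d$ to $K$. In particular $\mathbb{CP}^2\setminus C_d$ and $K$ are homotopy equivalent.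
   Context: A strong deformation retraction from a space $X$ to a subspace $A\subseteq X$ is a continuous map $H:X\times[0,1]\to X$ with $H(x,0)=x$ and $H(x,1)\in A$ for all $x\in X$, and $H(a,t)=a$ for all $a\in A$, $t\in[0,1]$. Let $M_d=\{(x,y,z)\in\mathbb{C}^3\mid x^d+y^d+z^d=1\}$, $S_d=\{(x,y,z)\in M_d\mid x^d,y^d,z^d\in\mathbb{R}_{\ge 0}\}$ and $N_d=\{(x,y,z)\in M_d\mid x^d,y^d,z^d\in\mathbb{R}\}$. Every point of $\mathbb{CP}^2\setminus C_d$ has a representative in $M_d$, unique up to multiplication by a $d$-th root of unity, and $K$ is the image of $S_d$ under $(x,y,z)\mapsto[x:y:z]$. The retraction $\tilde r$ of $M_d$ onto $S_d$ is the concatenation of two steps: $\tilde r(p,t)=\tilde r_1(p,2t)$ for $t\in[0,1/2]$ and $\tilde r(p,t)=\tilde r_2(\tilde r_1(p,1),2t-1)$ for $t\in[1/2,1]$. Step 1. For $w=a+ib\in\mathbb{C}$ with $a,b\in\mathbb{R}$ put $\bar r(w,t)=a+i(1-t)b$. Divide $\mathbb{C}$ into the $2d$ closed sectors $\{\rho e^{i\theta}\mid \rho\ge 0,\ \theta\in[(k-1)\pi/d,k\pi/d]\}$, $k=1,\dots,2d$; the map $u\mapsto u^d$ sends each sector homeomorphically onto the closed upper or lower half plane. For $u\in\mathbb{C}$, let $G(u,t)$ be the unique $d$-th root of $\bar r(u^d,t)$ lying in the same closed sector as $u$ (this does not depend on the choice of sector if $u$ lies in several). Then $\tilde r_1:M_d\times[0,1]\to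 M_d$ is $\tilde r_1((x,y,z),t)=(G(x,t),G(y,t),G(z,t))$, and $\tilde r_1(p,1)\in N_d$. Step 2. For real $(a,b,c)$ with $a+b+c=1$, put $r_2((a,b,c),t)=(1-t)(a,b,c)+tP_{(a,b,c)}$, where $P_{(a,b,c)}=(a,b,c)$ if $a,b,c\ge 0$; $P_{(a,b,c)}=(1,0,0)$ if $a\ge0$, $b,c\le 0$; $P_{(a,b,c)}=(0,1,0)$ if $b\ge 0$, $a,c\le 0$; $P_{(a,b,c)}=(0,0,1)$ if $c\ge 0$, $a,b\le 0$; $P_{(a,b,c)}=\left(\frac{a}{1-c},\frac{b}{1-c},0\right)$ if $a,b\ge 0$, $c\le 0$; $P_{(a,b,c)}=\left(\frac{a}{1-b},0,\frac{c}{1-b}\right)$ if $a,c\ge 0$, $b\le 0$; $P_{(a,b,c)}=\left(0,\frac{b}{1-a},\frac{c}{1-a}\right)$ if $b,c\ge 0$, $a\le 0$. For $(x,y,z)\in N_d$, $\tilde r_2((x,y,z),t)$ is the unique point $(x',y',z')\in N_d$ such that $(x'^d,y'^d,z'^d)=r_2((x^d,y^d,z^d),t)$ and $x',y',z'$ are nonnegative real multiples of $x,y,z$ respectively. *)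

theory Defs
  imports "HOL-Analysis.Analysis"
begin

type_synonym C3 = "complex \<times> complex \<times> complex"

text \<open>The point \<open>[x:y:z]\<close> is encoded as the orbit of \<open>(x,y,z)\<close> under multiplication by nonzero
  scalars, so that it contains all its homogeneous coordinates but not the origin. The value at
  the origin is irrelevant: it is not a point of \<open>CP2\<close>.\<close>
definition proj :: "C3 \<Rightarrow> C3 set" where
  "proj = (\<lambda>(x, y, z). {(c * x, c * y, c * z) | c. c \<noteq> 0})"

definition CP2_topology :: "C3 set topology" where
  "CP2_topology = topology (\<lambda>U. U \<subseteq> proj ` (UNIV - {0}) \<and> open {v. v \<noteq> 0 \<and> proj v \<in> U})"

lemma openin_CP2_topology:
  "openin CP2_topology U \<longleftrightarrow>
     U \<subseteq> proj ` (UNIV - {0}) \<and> open {v. v \<noteq> 0 \<and> proj v \<in> U}"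
proof -
  let ?P = "\<lambda>U. U \<subseteq> proj ` (UNIV - {0}) \<and> open {v. v \<noteq> 0 \<and> proj v \<in> U}"
  have "istopology ?P"
    unfolding istopology_def
  proof (intro conjI allI impI)
    fix S T assume "?P S" "?P T"
    moreover have "{v. v \<noteq> 0 \<and> proj v \<in> S \<inter> T} =
        {v. v \<noteq> 0 \<and> proj v \<in> S} \<inter> {v. v \<noteq> 0 \<and> proj v \<in> T}" by blast
    ultimately show "S \<inter> T \<subseteq> proj ` (UNIV - {0})" "open {v. v \<noteq> 0 \<and> proj v \<in> S \<inter> T}"
      by (blast, simp add: open_Int)
  next
    fix \<K> assume *: "\<forall>S\<in>\<K>. ?P S"
    then show "\<Union>\<K> \<subseteq> proj ` (UNIV - {0})" by blast
    have "{v. v \<noteq> 0 \<and> proj v \<in> \<Union>\<K>} = (\<Union>S\<in>\<K>. {v. v \<noteq> 0 \<and> proj v \<in> S})" by blast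
    with * show "open {v. v \<noteq> 0 \<and> proj v \<in> \<Union>\<K>}" by auto
  qed
  then show ?thesis
    unfolding CP2_topology_def by (simp only: topology_inverse')
qed

lemma topspace_CP2: "topspace CP2_topology = proj ` (UNIV - {0})"
proof -
  have "{v. v \<noteq> 0 \<and> proj v \<in> proj ` (UNIV - {0})} = UNIV - {0}" by blast
  then have "openin CP2_topology (proj ` (UNIV - {0}))"
    by (simp add: openin_CP2_topology open_Diff)
  then show ?thesis
    using openin_CP2_topology openin_subset openin_topspace by blast
qed

lemma quotient_map_proj: "quotient_map (top_of_set (UNIV - {0})) CP2_topology proj"
proof -
  have "open (UNIV - {0 :: C3})" by (simp add: open_Diff)
  moreover have "{x \<in> UNIV - {0}. proj x \<in> U} = {v. v \<noteq> 0 \<and> proj v \<in> U}" for U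
    by blast
  ultimately show ?thesis
    unfolding quotient_map_def topspace_CP2 topspace_euclidean_subtopology openin_CP2_topology
    by (simp only: openin_open_eq) blast
qed

definition curve_C :: "nat \<Rightarrow> C3 set set" where
  "curve_C d = {proj (x, y, z) | x y z. (x, y, z) \<noteq> 0 \<and> x ^ d + y ^ d + z ^ d = 0}"

definition curve_complement :: "nat \<Rightarrow> C3 set topology" where
  "curve_complement d = subtopology CP2_topology (topspace CP2_topology - curve_C d)"

definition K :: "nat \<Rightarrow> C3 set set" where
  "K d = {q \<in> topspace (curve_complement d).
     \<exists>x y z. (x, y, z) \<in> q \<and>
       x ^ d \<in> \<real>\<^sub>\<ge>\<^sub>0 \<and> y ^ d \<in> \<real>\<^sub>\<ge>\<^sub>0 \<and> z ^ d \<in> \<real>\<^sub>\<ge>\<^sub>0}"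

definition M :: "nat \<Rightarrow> C3 set" where
  "M d = {(x, y, z). x ^ d + y ^ d + z ^ d = 1}"

definition N :: "nat \<Rightarrow> C3 set" where
  "N d = {(x, y, z) \<in> M d. x ^ d \<in> \<real> \<and> y ^ d \<in> \<real> \<and> z ^ d \<in> \<real>}"

definition strong_deformation_retraction ::
    "'a topology \<Rightarrow> 'a set \<Rightarrow> ('a \<times> real \<Rightarrow> 'a) \<Rightarrow> bool" where
  "strong_deformation_retraction X A H \<longleftrightarrow>
     A \<subseteq> topspace X \<and>
     continuous_map (prod_topology X (top_of_set {0..1})) X H \<and>
     (\<forall>x \<in> topspace X. H (x, 0) = x \<and> H (x, 1) \<in> A) \<and>
     (\<forall>a \<in> A. \<forall>t \<in> {0..1}. H (a, t) = a)"

definition rbar :: "complex \<Rightarrow> real \<Rightarrow> complex" where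
  "rbar w t = Complex (Re w) ((1 - t) * Im w)"

definition sector :: "nat \<Rightarrow> nat \<Rightarrow> complex set" where
  "sector d k = {rcis \<rho> \<theta> | \<rho> \<theta>. \<rho> \<ge> 0 \<and> \<theta> \<in> {(real k - 1) * pi / d .. real k * pi / d}}"

definition G :: "nat \<Rightarrow> complex \<Rightarrow> real \<Rightarrow> complex" where
  "G d u t = (THE v. v ^ d = rbar (u ^ d) t \<and>
                     (\<exists>k \<in> {1..2 * d}. u \<in> sector d k \<and> v \<in> sector d k))"

definition r1_tilde :: "nat \<Rightarrow> C3 \<Rightarrow> real \<Rightarrow> C3" where
  "r1_tilde d = (\<lambda>(x, y, z) t. (G d x t, G d y t, G d z t))"

text \<open>The cases overlap only where their values agree; the final \<open>else\<close> branch covers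
  \<open>a \<le> 0\<close> and \<open>b, c \<ge> 0\<close>, the only remaining sign pattern when \<open>a + b + c = 1\<close>.\<close>
definition P :: "real \<times> real \<times> real \<Rightarrow> real \<times> real \<times> real" where
  "P = (\<lambda>(a, b, c).
     if a \<ge> 0 \<and> b \<ge> 0 \<and> c \<ge> 0 then (a, b, c)
     else if a \<ge> 0 \<and> b \<le> 0 \<and> c \<le> 0 then (1, 0, 0)
     else if b \<ge> 0 \<and> a \<le> 0 \<and> c \<le> 0 then (0, 1, 0)
     else if c \<ge> 0 \<and> a \<le> 0 \<and> b \<le> 0 then (0, 0, 1)
     else if a \<ge> 0 \<and> b \<ge> 0 \<and> c \<le> 0 then (a / (1 - c), b / (1 - c), 0)
     else if a \<ge> 0 \<and> c \<ge> 0 \<and> b \<le> 0 then (a / (1 - b), 0, c / (1 - b))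
     else (0, b / (1 - a), c / (1 - a)))"

definition r2 :: "real \<times> real \<times> real \<Rightarrow> real \<Rightarrow> real \<times> real \<times> real" where
  "r2 p t = (1 - t) *\<^sub>R p + t *\<^sub>R P p"

text \<open>On \<open>N d\<close> the \<open>d\<close>-th powers are real, so taking \<open>Re\<close> only changes their type.\<close>
definition r2_tilde :: "nat \<Rightarrow> C3 \<Rightarrow> real \<Rightarrow> C3" where
  "r2_tilde d = (\<lambda>(x, y, z) t. THE p'. case p' of (x', y', z') \<Rightarrow>
     (x', y', z') \<in> N d \<and>
     (Re (x' ^ d), Re (y' ^ d), Re (z' ^ d)) = r2 (Re (x ^ d), Re (y ^ d), Re (z ^ d)) t \<and>
     (\<exists>\<alpha> \<ge> 0. x' = complex_of_real \<alpha> * x) \<and>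
     (\<exists>\<beta> \<ge> 0. y' = complex_of_real \<beta> * y) \<and>
     (\<exists>\<gamma> \<ge> 0. z' = complex_of_real \<gamma> * z))"

definition r_tilde :: "nat \<Rightarrow> C3 \<Rightarrow> real \<Rightarrow> C3" where
  "r_tilde d p t =
     (if t \<le> 1 / 2 then r1_tilde d p (2 * t) else r2_tilde d (r1_tilde d p 1) (2 * t - 1))"

end

theory Submission
  imports Defs
begin

text \<open>On \<open>M d\<close> both steps only move the triple of \<open>d\<close>-th powers inside \<open>a + b + c = 1\<close>: its imaginary
  parts are shrunk, and then its real part moves to its positive part divided by the mass of that
  part, which is what all seven cases of \<open>P\<close> say. A power \<open>a\<close> never leaves the open half plane
  around \<open>a\<close>, except for \<open>0\<close>, so the motion lifts to the coordinates as
  \<open>x \<cdot> (e / a) powr (1 / d)\<close> with the principal root. Written with \<open>a = x ^ d / s\<close>, where \<open>s\<close>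
  is the sum of the powers, this formula is homogeneous of degree 1 and continuous on the whole
  cone \<open>s \<noteq> 0\<close>. Hence it descends along the quotient map \<open>proj\<close>, whose product with the compact
  interval is again a quotient map.\<close>

section \<open>Lifting paths of powers through the principal root\<close>

definition root_lift :: "nat \<Rightarrow> complex \<Rightarrow> complex \<Rightarrow> complex \<Rightarrow> complex" where
  "root_lift d x a e = x * (e / a) powr (1 / of_nat d)"

text \<open>Keeps \<open>e / a\<close> off the branch cut of the principal power. Since division by
  0 gives 0, it also forces \<open>e = 0\<close> whenever \<open>a = 0\<close>.\<close>

definition acute :: "complex \<Rightarrow> complex \<Rightarrow> bool" where
  "acute a e \<longleftrightarrow> e = 0 \<or> Re (e / a) > 0"

lemma root_lift_mult: "root_lift d (c * x) a e = c * root_lift d x a e"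
  by (simp add: root_lift_def)

lemma powr_inverse_power: "d \<ge> 1 \<Longrightarrow> ((w::complex) powr (1 / of_nat d)) ^ d = w"
  by (cases "w = 0") (simp_all add: powr_def exp_of_nat_mult [symmetric])

lemma root_lift_power:
  assumes "d \<ge> 1" "x ^ d = s * a" "acute a e"
  shows "root_lift d x a e ^ d = s * e"
  using assms by (cases "a = 0") (auto simp: root_lift_def power_mult_distrib powr_inverse_power acute_def)

lemma root_lift_same: "x ^ d = s * a \<Longrightarrow> s \<noteq> 0 \<Longrightarrow> d \<ge> 1 \<Longrightarrow> root_lift d x a a = x"
  by (cases "a = 0") (auto simp: root_lift_def)

text \<open>The principal power is multiplicative when one factor is a nonnegative real. This yields
  the nonnegative multiples that \<open>r2_tilde\<close> asks for.\<close>

lemma root_lift_of_real_mult: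
  assumes "l \<ge> 0"
  shows "root_lift d x a (of_real l * e) = of_real (l powr (1 / d)) * root_lift d x a e"
proof -
  have "(of_real l * (e / a)) powr (1 / of_nat d)
      = of_real l powr (1 / of_nat d) * (e / a) powr (1 / of_nat d)"
    using assms by (intro powr_times_real_left) auto
  also have "of_real l powr (1 / of_nat d :: complex) = of_real (l powr (1 / d))"
    using assms powr_of_real[of l "1 / d"] by simp
  finally show ?thesis by (simp add: root_lift_def mult_ac)
qed

text \<open>Where \<open>e\<close> is nonzero, \<open>e / a\<close> lies in the right half plane and
  the principal power is continuous. Where \<open>e\<close> vanishes, \<open>a\<close> may vanish
  too and \<open>e / a\<close> need not converge; there the norm of the lift, the
  \<open>d\<close>-th root of \<open>norm (s * e)\<close>, tends to 0.\<close>

lemma continuous_on_root_lift: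
  fixes S :: "'a::topological_space set"
  assumes "d \<ge> 1" "continuous_on S x" "continuous_on S a" "continuous_on S e" "continuous_on S s"
    and power: "\<And>z. z \<in> S \<Longrightarrow> x z ^ d = s z * a z"
    and acute: "\<And>z. z \<in> S \<Longrightarrow> acute (a z) (e z)"
  shows "continuous_on S (\<lambda>z. root_lift d (x z) (a z) (e z))"
  unfolding continuous_on_def
proof
  fix z assume z: "z \<in> S"
  let ?f = "\<lambda>z. root_lift d (x z) (a z) (e z)"
  note lims = assms(2-5)[unfolded continuous_on_def, rule_format, OF z]
  show "(?f \<longlongrightarrow> ?f z) (at z within S)"
  proof (cases "e z = 0")
    case True
    have *: "?f y ^ d = s y * e y" if "y \<in> S" for y
      using root_lift_power assms(1) power acute that by blast
    have "((\<lambda>y. root d (norm (s y * e y))) \<longlongrightarrow> root d (norm (s z * e z))) (at z within S)"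
      by (intro tendsto_intros lims)
    moreover have "root d (norm (s y * e y)) = norm (?f y)" if "y \<in> S" for y
      using *[OF that] assms(1) by (metis norm_ge_zero norm_power real_root_power_cancel less_eq_Suc_le One_nat_def)
    ultimately have "((\<lambda>y. norm (?f y)) \<longlongrightarrow> 0) (at z within S)"
      using True by (auto simp: eventually_at_filter elim: Lim_transform_eventually)
    with True show ?thesis by (simp add: root_lift_def tendsto_norm_zero_iff)
  next
    case False
    with acute[OF z] have "Re (e z / a z) > 0" "a z \<noteq> 0" by (auto simp: acute_def)
    then show ?thesis
      unfolding root_lift_def
      by (intro tendsto_intros lims disjI1) (auto simp: complex_nonpos_Reals_iff)
  qed
qed

text \<open>Up to the positive factor \<open>(cmod a)\<^sup>2\<close>, the real part of the quotient
  is \<open>l * (Re a)\<^sup>2 + \<mu> * (Im a)\<^sup>2\<close>, which vanishes only if both new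
  parts do.\<close>

lemma acute_scaled_parts:
  assumes "l \<ge> 0" "\<mu> \<ge> 0"
  shows "acute a (Complex (l * Re a) (\<mu> * Im a))"
proof (cases "l * Re a = 0 \<and> \<mu> * Im a = 0")
  case False
  then have "l * (Re a)\<^sup>2 \<noteq> 0 \<or> \<mu> * (Im a)\<^sup>2 \<noteq> 0" by simp
  moreover have "l * (Re a)\<^sup>2 \<ge> 0" "\<mu> * (Im a)\<^sup>2 \<ge> 0" using assms by auto
  ultimately have "0 < l * (Re a)\<^sup>2 + \<mu> * (Im a)\<^sup>2" by linarith
  moreover have "(Re a)\<^sup>2 + (Im a)\<^sup>2 > 0" using False by (auto simp flip: complex_neq_0)
  ultimately show ?thesis
    by (simp add: acute_def Re_divide power2_eq_square mult_ac)
qed (auto simp: acute_def complex_eq_iff)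

lemma rbar_acute: "t \<le> 1 \<Longrightarrow> acute w (rbar w t)"
  using acute_scaled_parts[of 1 "1 - t" w] by (simp add: rbar_def)

section \<open>Sectors and the closed form of \<open>G\<close>\<close>

lemma rcis_power_powr_inverse:
  assumes "d \<ge> 1" "s \<ge> 0" "\<bar>d * \<delta>\<bar> < pi"
  shows "(rcis s \<delta> ^ d) powr (1 / of_nat d) = rcis s \<delta>"
proof (cases "s = 0")
  case False
  define L where "L = Complex (ln s) \<delta>"
  have L: "rcis s \<delta> = exp L"
    using False assms by (simp add: L_def exp_eq_polar rcis_def)
  have "Ln (exp L ^ d) = of_nat d * L"
    unfolding exp_of_nat_mult [symmetric]
    using assms(3) by (intro Ln_exp) (auto simp: L_def)
  then show ?thesis
    using assms(1) by (simp add: L powr_def)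
qed (use assms in auto)

text \<open>Two points of one sector differ in argument by at most \<open>pi / d\<close>. The
  extreme value would give \<open>(v / u) ^ d\<close> a nonpositive real part, so
  \<open>v / u\<close> is the principal root of \<open>e / u ^ d\<close>.\<close>

lemma root_lift_unique_in_sector:
  assumes d: "d \<ge> 1" and v: "v ^ d = e" and "u \<in> sector d k" "v \<in> sector d k"
    and "acute (u ^ d) e"
  shows "v = root_lift d u (u ^ d) e"
proof (cases "e = 0")
  case True
  then show ?thesis using v d by (simp add: root_lift_def)
next
  case False
  obtain \<rho> \<phi> r \<theta> where *: "u = rcis \<rho> \<phi>" "\<rho> \<ge> 0" "v = rcis r \<theta>" "r \<ge> 0"
    and "\<phi> \<in> {(real k - 1) * pi / d .. real k * pi / d}" "\<theta> \<in> {(real k - 1) * pi / d .. real k * pi / d}"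
    using assms unfolding sector_def by blast
  then have "(real k - 1) * pi \<le> d * \<phi>" "d * \<phi> \<le> real k * pi"
     "(real k - 1) * pi \<le> d * \<theta>" "d * \<theta> \<le> real k * pi"
    using d by (auto simp: field_simps)
  then have le: "\<bar>d * (\<theta> - \<phi>)\<bar> \<le> pi" by (auto simp: algebra_simps abs_le_iff)
  have pos: "Re (e / u ^ d) > 0" using False assms by (simp add: acute_def)
  then have u: "u \<noteq> 0" using d by (auto simp: zero_power)
  have q: "v / u = rcis (r / \<rho>) (\<theta> - \<phi>)" using * by (simp add: rcis_divide)
  have qd: "(v / u) ^ d = e / u ^ d" using v by (simp add: power_divide)
  have "\<bar>d * (\<theta> - \<phi>)\<bar> \<noteq> pi"
  proof
    assume "\<bar>d * (\<theta> - \<phi>)\<bar> = pi"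
    then have "cos (d * (\<theta> - \<phi>)) = - 1" by (metis cos_abs_real cos_pi)
    then have "Re ((v / u) ^ d) = - ((r / \<rho>) ^ d)" by (simp add: q DeMoivre2)
    moreover have "(r / \<rho>) ^ d \<ge> 0" using * by simp
    ultimately show False using pos qd by simp
  qed
  with le have "(e / u ^ d) powr (1 / of_nat d) = v / u"
    unfolding qd [symmetric] q using * d by (intro rcis_power_powr_inverse) auto
  then show ?thesis using u by (simp add: root_lift_def)
qed

lemma exists_sector:
  assumes "d \<ge> 1" shows "\<exists>k\<in>{1..2*d}. u \<in> sector d k"
proof -
  define \<phi> where "\<phi> = Arg2pi u"
  have \<phi>: "0 \<le> \<phi>" "\<phi> < 2 * pi" "u = rcis (cmod u) \<phi>"
    using Arg2pi_ge_0 Arg2pi_lt_2pi Arg2pi_eq[of u] by (auto simp: \<phi>_def rcis_def cis_conv_exp)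
  \<comment> \<open>Sectors are numbered from 1, so the sector found has index
    \<open>Suc m\<close>.\<close>
  define m where "m = nat \<lfloor>d * \<phi> / pi\<rfloor>"
  have "0 \<le> d * \<phi> / pi" using \<phi> by simp
  then have m: "real m \<le> d * \<phi> / pi" "d * \<phi> / pi < real m + 1"
    unfolding m_def by linarith+
  moreover have "d * \<phi> / pi < 2 * d" using \<phi> assms by (simp add: field_simps)
  ultimately have "Suc m \<in> {1..2 * d}" by (auto simp: Suc_le_eq)
  moreover have "\<phi> \<in> {(real (Suc m) - 1) * pi / d .. real (Suc m) * pi / d}"
    using m assms by (auto simp: field_simps)
  ultimately show ?thesis
    unfolding sector_def using \<phi>(3) norm_ge_zero by blast
qed

text \<open>Shrinking the imaginary part by a factor \<open>1 - t \<ge> 0\<close> never takes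
  \<open>u ^ d\<close> across the real axis, and its argument turns by less than a right angle.
  Hence the argument of the power stays in the interval of length \<open>pi\<close> belonging to the
  sector; dividing by \<open>d\<close> gives the claim.\<close>

lemma root_lift_rbar_in_sector:
  assumes d: "d \<ge> 1" and t: "t \<le> 1" and k: "k \<ge> 1" and "u \<in> sector d k"
  shows "root_lift d u (u ^ d) (rbar (u ^ d) t) \<in> sector d k" (is "?v \<in> _")
proof (cases "rbar (u ^ d) t = 0")
  case True
  have "0 = rcis 0 (k * pi / d)" "k * pi / d \<in> {(real k - 1) * pi / d .. real k * pi / d}"
    using d by (auto simp: field_simps)
  then have "0 \<in> sector d k" unfolding sector_def by blast
  then show ?thesis using True by (simp add: root_lift_def)
next
  case False
  define e where "e = rbar (u ^ d) t"
  define z where "z = e / u ^ d"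
  define \<alpha> where "\<alpha> = Arg z"
  obtain \<rho> \<phi> where u: "u = rcis \<rho> \<phi>" "\<rho> \<ge> 0"
    and "\<phi> \<in> {(real k - 1) * pi / d .. real k * pi / d}"
    using assms unfolding sector_def by blast
  then have \<phi>: "(real k - 1) * pi \<le> d * \<phi>" "d * \<phi> \<le> real k * pi"
    using d by (auto simp: field_simps)
  \<comment> \<open>The argument of \<open>u ^ d\<close>, measured from the lower edge of the
    \<open>d\<close>-fold sector.\<close>
  define \<psi> where "\<psi> = d * \<phi> - (real k - 1) * pi"
  have \<psi>: "0 \<le> \<psi>" "\<psi> \<le> pi" using \<phi> by (auto simp: \<psi>_def algebra_simps)
  have z: "Re z > 0" using False rbar_acute[OF t, of "u ^ d"] by (simp add: z_def e_def acute_def)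
  then have u0: "u \<noteq> 0" "\<rho> > 0" and z0: "z \<noteq> 0"
    using d u by (auto simp: z_def zero_power intro: le_neq_trans)
  have \<alpha>: "\<bar>\<alpha>\<bar> < pi / 2" using z z0 Re_Ln_pos_lt by (simp add: \<alpha>_def Arg_eq_Im_Ln)
  have zr: "z = rcis (cmod z) \<alpha>" by (simp add: \<alpha>_def rcis_cmod_Arg)
  have w: "u ^ d = rcis (\<rho> ^ d) (d * \<phi>)" using u by (simp add: DeMoivre2)
  have e: "e = rcis (\<rho> ^ d * cmod z) (d * \<phi> + \<alpha>)"
    using u0 zr rcis_mult[of "\<rho> ^ d" "d * \<phi>" "cmod z" \<alpha>] w by (simp add: z_def)
  \<comment> \<open>Odd and even sectors are mapped to the upper and the lower half plane; this sign
    occurs on both sides of the equation below and cancels.\<close>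
  have shift: "sin (d * \<phi> + \<beta>) = (- 1) ^ (k - 1) * sin (\<psi> + \<beta>)" for \<beta>
  proof -
    have "d * \<phi> + \<beta> = (\<psi> + \<beta>) + real (k - 1) * pi"
      using k by (simp add: \<psi>_def)
    then have "sin (d * \<phi> + \<beta>) = sin ((\<psi> + \<beta>) + real (k - 1) * pi)" by (rule arg_cong)
    also have "\<dots> = (- 1) ^ (k - 1) * sin (\<psi> + \<beta>)"
      by (subst sin_add) simp
    finally show ?thesis .
  qed
  have "Im e = (1 - t) * Im (u ^ d)" by (simp add: e_def rbar_def)
  then have "(- 1) ^ (k - 1) * (\<rho> ^ d * cmod z * sin (\<psi> + \<alpha>)) =
      (- 1) ^ (k - 1) * ((1 - t) * (\<rho> ^ d * sin \<psi>))"
    using shift[of \<alpha>] shift[of 0] unfolding e w by (simp add: mult_ac)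
  then have "\<rho> ^ d * cmod z * sin (\<psi> + \<alpha>) = (1 - t) * (\<rho> ^ d * sin \<psi>)" by simp
  moreover have "0 \<le> (1 - t) * (\<rho> ^ d * sin \<psi>)"
    using t u0 \<psi> sin_ge_zero by (intro mult_nonneg_nonneg) auto
  moreover have "\<rho> ^ d * cmod z > 0" using u0 z0 by simp
  ultimately have sin: "sin (\<psi> + \<alpha>) \<ge> 0" by (metis zero_le_mult_iff not_less)
  \<comment> \<open>The sum lies strictly between \<open>- pi / 2\<close> and
    \<open>3 * pi / 2\<close>, where a nonnegative sine means lying in
    \<open>{0..pi}\<close>.\<close>
  have "\<psi> + \<alpha> \<ge> 0"
    using sin_gt_zero[of "- (\<psi> + \<alpha>)"] sin \<psi> \<alpha> pi_gt_zero
    by (smt (verit) sin_minus field_sum_of_halves)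
  moreover have "\<psi> + \<alpha> \<le> pi"
    using sin_lt_zero[of "\<psi> + \<alpha>"] sin \<psi> \<alpha> pi_gt_zero by (smt (verit) field_sum_of_halves)
  ultimately have arg: "\<phi> + \<alpha> / d \<in> {(real k - 1) * pi / d .. real k * pi / d}"
    using d by (simp add: \<psi>_def pos_divide_le_eq pos_le_divide_eq distrib_right) (simp add: algebra_simps)
  have "rcis (root d (cmod z)) (\<alpha> / d) ^ d = rcis (cmod z) \<alpha>"
    using d by (simp add: DeMoivre2)
  then have "z = rcis (root d (cmod z)) (\<alpha> / d) ^ d"
    using zr by simp
  moreover have "\<bar>d * (\<alpha> / d)\<bar> < pi" using \<alpha> d pi_gt_zero by simp
  ultimately have "z powr (1 / of_nat d) = rcis (root d (cmod z)) (\<alpha> / d)"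
    using rcis_power_powr_inverse[OF d, of "root d (cmod z)" "\<alpha> / d"] by (simp add: real_root_ge_zero)
  then have "?v = rcis (\<rho> * root d (cmod z)) (\<phi> + \<alpha> / d)"
    unfolding root_lift_def e_def[symmetric] z_def[symmetric] using u by (simp add: rcis_mult)
  moreover have "\<rho> * root d (cmod z) \<ge> 0" using u by (simp add: real_root_ge_zero)
  ultimately show ?thesis unfolding sector_def using arg by blast
qed

text \<open>The uniqueness statement gives a value in which \<open>k\<close> does not occur, so
  \<open>THE\<close> is justified even when \<open>u\<close> lies in several sectors.\<close>

lemma G_eq_root_lift:
  assumes "d \<ge> 1" "t \<le> 1"
  shows "G d u t = root_lift d u (u ^ d) (rbar (u ^ d) t)"
  unfolding G_def
proof (rule the_equality)
  obtain k where "k \<in> {1..2*d}" "u \<in> sector d k" using exists_sector assms by blast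
  then show "root_lift d u (u ^ d) (rbar (u ^ d) t) ^ d = rbar (u ^ d) t \<and>
      (\<exists>k\<in>{1..2*d}. u \<in> sector d k \<and> root_lift d u (u ^ d) (rbar (u ^ d) t) \<in> sector d k)"
    using assms root_lift_power[of d u 1 "u ^ d"] rbar_acute root_lift_rbar_in_sector by auto
qed (use assms rbar_acute root_lift_unique_in_sector in blast)

section \<open>The path of powers and its homogeneous lift\<close>

lemma P_eq_positive_part:
  assumes "a + b + c = 1"
  defines "\<sigma> \<equiv> max a 0 + max b 0 + max c 0"
  shows "P (a, b, c) = (max a 0 / \<sigma>, max b 0 / \<sigma>, max c 0 / \<sigma>)"
proof -
  have "c = 1 - a - b" using assms by simp
  then show ?thesis by (auto simp: P_def \<sigma>_def max_def add_divide_distrib)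
qed

definition power_sum :: "nat \<Rightarrow> C3 \<Rightarrow> complex" where
  "power_sum d = (\<lambda>(x, y, z). x ^ d + y ^ d + z ^ d)"

text \<open>Division by the power sum makes this invariant under scaling; on \<open>M d\<close> it
  is the denominator in \<open>P_eq_positive_part\<close>.\<close>

definition pos_mass :: "nat \<Rightarrow> C3 \<Rightarrow> real" where
  "pos_mass d v = (case v of (x, y, z) \<Rightarrow>
     max (Re (x ^ d / power_sum d v)) 0 + max (Re (y ^ d / power_sum d v)) 0 +
     max (Re (z ^ d / power_sum d v)) 0)"

text \<open>The truncations at \<open>t = 1 / 2\<close> replace the case distinction of the concatenated homotopy;
  \<open>\<sigma>\<close> stands for the mass of the positive part.\<close>
definition power_path :: "complex \<Rightarrow> real \<Rightarrow> real \<Rightarrow> complex" where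
  "power_path a \<sigma> t = (let \<tau> = max 0 (2 * t - 1) in
     Complex ((1 - \<tau>) * Re a + \<tau> * (max (Re a) 0 / \<sigma>)) ((1 - min 1 (2 * t)) * Im a))"

text \<open>The point \<open>v\<close> enters only through its power sum and positive mass, so one
  argument serves all three coordinates \<open>x\<close>.\<close>

definition path_lift :: "nat \<Rightarrow> C3 \<Rightarrow> real \<Rightarrow> complex \<Rightarrow> complex" where
  "path_lift d v t x = root_lift d x (x ^ d / power_sum d v)
     (power_path (x ^ d / power_sum d v) (pos_mass d v) t)"

definition cone_retraction :: "nat \<Rightarrow> C3 \<Rightarrow> real \<Rightarrow> C3" where
  "cone_retraction d v t =
     (case v of (x, y, z) \<Rightarrow> (path_lift d v t x, path_lift d v t y, path_lift d v t z))"

text \<open>\<open>max (Re a) 0\<close> is either \<open>Re a\<close> or 0, so both parts of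
  \<open>a\<close> are only rescaled. This serves for acuteness and, with \<open>\<mu> = 0\<close>,
  for motion along rays in the second half.\<close>

lemma power_path_scaled:
  assumes "\<sigma> > 0" "0 \<le> t" "t \<le> 1"
  obtains l \<mu> where "l \<ge> 0" "\<mu> \<ge> 0" "power_path a \<sigma> t = Complex (l * Re a) (\<mu> * Im a)"
    "1 / 2 \<le> t \<Longrightarrow> \<mu> = 0"
proof -
  define \<tau> where "\<tau> = max 0 (2 * t - 1)"
  have \<tau>: "0 \<le> \<tau>" "\<tau> \<le> 1" using assms by (auto simp: \<tau>_def)
  let ?l = "(1 - \<tau>) + \<tau> * (if Re a > 0 then 1 / \<sigma> else 0)"
  have "?l \<ge> 0" using \<tau> assms by simp
  moreover have "power_path a \<sigma> t = Complex (?l * Re a) ((1 - min 1 (2 * t)) * Im a)"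
    by (cases "Re a > 0")
      (simp_all add: power_path_def flip: \<tau>_def add: distrib_right)
  ultimately show ?thesis using that[of ?l "1 - min 1 (2 * t)"] by simp
qed

lemma acute_power_path: "\<sigma> > 0 \<Longrightarrow> 0 \<le> t \<Longrightarrow> t \<le> 1 \<Longrightarrow> acute a (power_path a \<sigma> t)"
  by (metis power_path_scaled acute_scaled_parts)

text \<open>The real parts of the normalized powers add up to 1, and replacing negative ones by 0
  can only raise the sum.\<close>

lemma pos_mass_ge_1:
  assumes "power_sum d v \<noteq> 0" shows "pos_mass d v \<ge> 1"
proof -
  obtain x y z where v: "v = (x, y, z)" by (metis prod_cases3)
  define s where "s = power_sum d v"
  have "x ^ d / s + y ^ d / s + z ^ d / s = 1"
    using assms unfolding add_divide_distrib [symmetric] s_def by (simp add: v power_sum_def)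
  then have "Re (x ^ d / s) + Re (y ^ d / s) + Re (z ^ d / s) = 1"
    by (metis plus_complex.sel(1) one_complex.sel(1))
  moreover have "pos_mass d v = max (Re (x ^ d / s)) 0 + max (Re (y ^ d / s)) 0 + max (Re (z ^ d / s)) 0"
    by (simp add: pos_mass_def v s_def)
  ultimately show ?thesis by linarith
qed

text \<open>The imaginary parts sum to 0 and shrink by a common factor; the real parts form an
  affine combination of two triples of sum 1.\<close>

lemma power_path_sum:
  assumes "a + b + c = 1"
  defines "\<sigma> \<equiv> max (Re a) 0 + max (Re b) 0 + max (Re c) 0"
  shows "power_path a \<sigma> t + power_path b \<sigma> t + power_path c \<sigma> t = 1"
proof -
  have re: "Re a + Re b + Re c = 1" and im: "Im a + Im b + Im c = 0"
    using assms(1) by (simp_all flip: plus_complex.sel)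
  have "\<sigma> \<noteq> 0" using re by (simp add: \<sigma>_def max_def)
  then have "max (Re a) 0 / \<sigma> + max (Re b) 0 / \<sigma> + max (Re c) 0 / \<sigma> = 1"
    by (simp add: \<sigma>_def flip: add_divide_distrib)
  then have "(1 - \<tau>) * Re a + \<tau> * (max (Re a) 0 / \<sigma>) + ((1 - \<tau>) * Re b + \<tau> * (max (Re b) 0 / \<sigma>)) +
      ((1 - \<tau>) * Re c + \<tau> * (max (Re c) 0 / \<sigma>)) = 1" for \<tau>
    using re by (smt (verit) distrib_left mult_cancel_left1)
  moreover have "m * Im a + m * Im b + m * Im c = 0" for m
    using im by (metis distrib_left mult_zero_right)
  ultimately show ?thesis
    by (simp add: complex_eq_iff power_path_def Let_def)
qed

lemma power_path_0: "power_path a \<sigma> 0 = a"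
  by (simp add: power_path_def complex_eq_iff)

lemma power_path_1_nonneg: "\<sigma> > 0 \<Longrightarrow> power_path a \<sigma> 1 \<in> \<real>\<^sub>\<ge>\<^sub>0"
  by (simp add: power_path_def complex_nonneg_Reals_iff)

lemma power_path_nonneg: "a \<in> \<real>\<^sub>\<ge>\<^sub>0 \<Longrightarrow> power_path a 1 t = a"
  by (auto simp: power_path_def complex_nonneg_Reals_iff complex_eq_iff Let_def algebra_simps)

lemma continuous_on_power_path:
  fixes S :: "'a::topological_space set"
  assumes "continuous_on S a" "continuous_on S \<sigma>" "continuous_on S t" "\<And>z. z \<in> S \<Longrightarrow> \<sigma> z \<noteq> 0"
  shows "continuous_on S (\<lambda>z. power_path (a z) (\<sigma> z) (t z))"
  unfolding power_path_def Let_def Complex_eq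
  by (intro continuous_intros assms) (use assms in auto)

lemma path_lift_power:
  assumes "d \<ge> 1" "power_sum d v \<noteq> 0" "0 \<le> t" "t \<le> 1"
  shows "path_lift d v t x ^ d =
    power_sum d v * power_path (x ^ d / power_sum d v) (pos_mass d v) t"
  unfolding path_lift_def
  using assms pos_mass_ge_1[OF assms(2)] by (intro root_lift_power acute_power_path) auto

lemma normalized_powers_sum:
  assumes "power_sum d (x, y, z) = s" "s \<noteq> 0"
  shows "x ^ d / s + y ^ d / s + z ^ d / s = 1"
  using assms by (simp add: power_sum_def flip: add_divide_distrib)

lemma power_sum_cone_retraction:
  assumes "d \<ge> 1" "power_sum d v \<noteq> 0" "0 \<le> t" "t \<le> 1"
  shows "power_sum d (cone_retraction d v t) = power_sum d v"
proof -
  obtain x y z where v: "v = (x, y, z)" by (metis prod_cases3)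
  define s where "s = power_sum d v"
  have "power_sum d (cone_retraction d v t) = s * (power_path (x ^ d / s) (pos_mass d v) t
      + power_path (y ^ d / s) (pos_mass d v) t + power_path (z ^ d / s) (pos_mass d v) t)"
    using path_lift_power[OF assms]
    by (simp add: v cone_retraction_def power_sum_def[of d] distrib_left s_def)
  also have "\<dots> = s"
    using power_path_sum[OF normalized_powers_sum[of d x y z s], of t] assms
    by (simp add: pos_mass_def v s_def)
  finally show ?thesis by (simp add: s_def)
qed

lemma power_sum_scale: "power_sum d (c * x, c * y, c * z) = c ^ d * power_sum d (x, y, z)"
  by (simp add: power_sum_def power_mult_distrib distrib_left)

lemma pos_mass_scale: "c \<noteq> 0 \<Longrightarrow> pos_mass d (c * x, c * y, c * z) = pos_mass d (x, y, z)"
  by (simp add: pos_mass_def power_sum_scale power_mult_distrib)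

text \<open>The normalized powers and the positive mass do not change under scaling, so only the
  leading factor of \<open>root_lift\<close> does.\<close>

lemma cone_retraction_scale:
  assumes "c \<noteq> 0" "cone_retraction d (x, y, z) t = (x', y', z')"
  shows "cone_retraction d (c * x, c * y, c * z) t = (c * x', c * y', c * z')"
  using assms
  by (auto simp: cone_retraction_def path_lift_def power_sum_scale pos_mass_scale root_lift_mult
      power_mult_distrib)

lemma continuous_on_cone_retraction:
  assumes "d \<ge> 1"
  shows "continuous_on ({v. power_sum d v \<noteq> 0} \<times> {0..1}) (\<lambda>(v, t). cone_retraction d v t)"
proof -
  let ?S = "{v. power_sum d v \<noteq> 0} \<times> {0..1::real}"
  have s: "continuous_on ?S (\<lambda>p. power_sum d (fst p))"
    unfolding power_sum_def case_prod_unfold by (intro continuous_intros)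
  have \<sigma>: "continuous_on ?S (\<lambda>p. pos_mass d (fst p))"
    unfolding pos_mass_def case_prod_unfold by (intro continuous_intros s) auto
  have pos: "pos_mass d (fst p) > 0" if "p \<in> ?S" for p
    using pos_mass_ge_1[of d "fst p"] that by auto
  have coordinate: "continuous_on ?S (\<lambda>p. path_lift d (fst p) (snd p) (f p))"
    if f: "continuous_on ?S f" for f
    unfolding path_lift_def
  proof (rule continuous_on_root_lift[OF assms f _ _ s])
    show "continuous_on ?S (\<lambda>p. f p ^ d / power_sum d (fst p))"
      by (intro continuous_intros f s) auto
    then show "continuous_on ?S (\<lambda>p. power_path (f p ^ d / power_sum d (fst p)) (pos_mass d (fst p)) (snd p))"
      by (intro continuous_on_power_path \<sigma> continuous_on_snd continuous_on_id) (use pos in force)+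
    show "acute (f p ^ d / power_sum d (fst p))
        (power_path (f p ^ d / power_sum d (fst p)) (pos_mass d (fst p)) (snd p))" if "p \<in> ?S" for p
      using that pos by (intro acute_power_path) auto
  qed auto
  show ?thesis
    unfolding cone_retraction_def case_prod_unfold
    by (intro continuous_on_Pair coordinate continuous_on_fst continuous_on_snd continuous_on_id)
qed

section \<open>Agreement with \<open>r_tilde\<close> on \<open>M d\<close>\<close>

lemma nonneg_multiple_unique:
  assumes "d \<ge> 1" "X = of_real \<alpha> * x" "Y = of_real \<beta> * x" "\<alpha> \<ge> 0" "\<beta> \<ge> 0"
    and "X ^ d = Y ^ d"
  shows "X = (Y :: complex)"
proof (cases "x = 0")
  case False
  then have "of_real (\<alpha> ^ d) = (of_real (\<beta> ^ d) :: complex)"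
    using assms by (auto simp: power_mult_distrib)
  then have "\<alpha> ^ d = \<beta> ^ d" by (simp only: of_real_eq_iff)
  then have "\<alpha> = \<beta>" using assms by (auto intro: power_eq_imp_eq_base)
  then show ?thesis using assms by simp
qed (use assms in auto)

lemma power_path_first_half: "t \<le> 1 / 2 \<Longrightarrow> power_path a \<sigma> t = rbar a (2 * t)"
  by (simp add: power_path_def rbar_def complex_eq_iff)

lemma power_path_second_half:
  assumes "1 / 2 \<le> t"
  shows "power_path a \<sigma> t = of_real ((2 - 2 * t) * Re a + (2 * t - 1) * (max (Re a) 0 / \<sigma>))"
  using assms by (simp add: power_path_def complex_eq_iff)

lemma path_lift_second_half:
  assumes "power_sum d v = 1" "1 / 2 \<le> t" "t \<le> 1"
  shows "\<exists>\<alpha>\<ge>0. path_lift d v t x = of_real \<alpha> * root_lift d x (x ^ d) (rbar (x ^ d) 1)"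
proof -
  have "pos_mass d v > 0" using pos_mass_ge_1[of d v] assms by simp
  then obtain l \<mu> where "l \<ge> 0" "\<mu> = 0"
      "power_path (x ^ d) (pos_mass d v) t = Complex (l * Re (x ^ d)) (\<mu> * Im (x ^ d))"
    using assms by (metis power_path_scaled order_trans half_gt_zero zero_less_one less_imp_le)
  then have "power_path (x ^ d) (pos_mass d v) t = of_real l * rbar (x ^ d) 1"
    by (simp add: rbar_def complex_eq_iff)
  then show ?thesis
    using root_lift_of_real_mult[OF \<open>l \<ge> 0\<close>, of d x "x ^ d"] assms
    by (intro exI[of _ "l powr (1 / d)"]) (simp add: path_lift_def)
qed

text \<open>The first half is the closed form of \<open>G\<close>. In the second half the lift is
  shown to satisfy the description under \<open>THE\<close> in \<open>r2_tilde\<close>, which has at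
  most one solution.\<close>

lemma r_tilde_eq_cone_retraction:
  assumes d: "d \<ge> 1" and p: "p \<in> M d" and t: "0 \<le> t" "t \<le> 1"
  shows "r_tilde d p t = cone_retraction d p t"
proof -
  obtain x y z where xyz: "p = (x, y, z)" by (metis prod_cases3)
  have s: "power_sum d p = 1" using p by (simp add: M_def power_sum_def xyz)
  show ?thesis
  proof (cases "t \<le> 1 / 2")
    case True
    then show ?thesis
      using d s t
      by (simp add: r_tilde_def r1_tilde_def xyz cone_retraction_def path_lift_def
          G_eq_root_lift power_path_first_half)
  next
    case False
    define first where "first u = root_lift d u (u ^ d) (rbar (u ^ d) 1)" for u
    define second where "second u = path_lift d p t u" for u
    have r1: "r1_tilde d p 1 = (first x, first y, first z)"
      using d by (simp add: r1_tilde_def xyz first_def G_eq_root_lift)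
    have first_power: "first u ^ d = of_real (Re (u ^ d))" for u
    proof -
      have "first u ^ d = 1 * rbar (u ^ d) 1"
        unfolding first_def using d rbar_acute by (intro root_lift_power) auto
      then show ?thesis by (simp add: rbar_def complex_eq_iff)
    qed
    have multiple: "\<exists>\<alpha>\<ge>0. second u = of_real \<alpha> * first u" for u
      unfolding first_def second_def using path_lift_second_half s False t by simp
    have second_power: "second u ^ d = of_real
        ((2 - 2 * t) * Re (u ^ d) + (2 * t - 1) * (max (Re (u ^ d)) 0 / pos_mass d p))" for u
      using path_lift_power[OF d _ t, of p u] s False
      by (simp add: second_def power_path_second_half)
    have "Re (x ^ d) + Re (y ^ d) + Re (z ^ d) = 1"
      using p by (simp add: M_def xyz flip: plus_complex.sel)
    moreover have "pos_mass d p = max (Re (x ^ d)) 0 + max (Re (y ^ d)) 0 + max (Re (z ^ d)) 0"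
      using s by (simp add: pos_mass_def xyz)
    \<comment> \<open>\<open>2 - 2 * t\<close> and \<open>2 * t - 1\<close> are the weights of
      \<open>r2\<close> at time \<open>2 * t - 1\<close>, and the positive part over its mass is
      \<open>P\<close>.\<close>
    ultimately have r2: "r2 (Re (first x ^ d), Re (first y ^ d), Re (first z ^ d)) (2 * t - 1) =
        (Re (second x ^ d), Re (second y ^ d), Re (second z ^ d))"
      unfolding r2_def first_power second_power Re_complex_of_real
      by (simp add: P_eq_positive_part)
    have N: "(second x, second y, second z) \<in> N d"
      using power_sum_cone_retraction[OF d _ t, of p] s second_power
      by (simp add: N_def M_def power_sum_def second_def xyz cone_retraction_def)
    \<comment> \<open>Real powers with equal real parts are equal, and on the ray through
      \<open>first u\<close> the \<open>d\<close>-th power is injective.\<close>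
    have unique: "u' = second u"
      if "u' ^ d \<in> \<real>" "Re (u' ^ d) = Re (second u ^ d)" "\<exists>\<alpha>\<ge>0. u' = of_real \<alpha> * first u" for u u'
    proof -
      have "u' ^ d = second u ^ d"
        using that second_power[of u] by (simp add: complex_eq_iff complex_is_Real_iff)
      then show ?thesis
        using that(3) multiple[of u] nonneg_multiple_unique[OF d] by metis
    qed
    have "r2_tilde d (first x, first y, first z) (2 * t - 1) = (second x, second y, second z)"
      unfolding r2_tilde_def prod.case r2
    proof (rule the_equality)
      show "case (second x, second y, second z) of (x', y', z') \<Rightarrow>
          (x', y', z') \<in> N d \<and>
          (Re (x' ^ d), Re (y' ^ d), Re (z' ^ d)) =
            (Re (second x ^ d), Re (second y ^ d), Re (second z ^ d)) \<and>
          (\<exists>\<alpha>\<ge>0. x' = of_real \<alpha> * first x) \<and> (\<exists>\<beta>\<ge>0. y' = of_real \<beta> * first y) \<and>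
          (\<exists>\<gamma>\<ge>0. z' = of_real \<gamma> * first z)"
        using N multiple by simp
    qed (auto simp: N_def intro!: unique)
    then show ?thesis
      using False by (simp add: r_tilde_def r1 cone_retraction_def second_def flip: xyz) (simp add: xyz)
  qed
qed

section \<open>Projective classes and the quotient map\<close>

lemma self_mem_proj: "v \<in> proj v"
  by (cases v) (auto simp: proj_def intro: exI[of _ 1])

lemma proj_eq_iff: "proj (x, y, z) = proj (x', y', z') \<longleftrightarrow> (\<exists>c\<noteq>0. (x', y', z') = (c * x, c * y, c * z))"
proof
  assume "proj (x, y, z) = proj (x', y', z')"
  then have "(x', y', z') \<in> proj (x, y, z)" using self_mem_proj by simp
  then show "\<exists>c\<noteq>0. (x', y', z') = (c * x, c * y, c * z)" by (auto simp: proj_def)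
next
  assume "\<exists>c\<noteq>0. (x', y', z') = (c * x, c * y, c * z)"
  then obtain c where c: "c \<noteq> 0" "x' = c * x" "y' = c * y" "z' = c * z" by auto
  \<comment> \<open>Multiplication by \<open>c\<close> permutes the nonzero scalars, so both orbits
    are the same set.\<close>
  have "\<exists>b. k = b * c \<and> b \<noteq> 0" if "k \<noteq> 0" for k
    using that c by (intro exI[of _ "k / c"]) auto
  then show "proj (x, y, z) = proj (x', y', z')"
    unfolding proj_def by (auto simp: c mult.assoc[symmetric])
qed

lemma proj_in_curve_C_iff:
  assumes "d \<ge> 1" "v \<noteq> 0"
  shows "proj v \<in> curve_C d \<longleftrightarrow> power_sum d v = 0"
proof
  assume "proj v \<in> curve_C d"
  then obtain x y z where "proj v = proj (x, y, z)" "power_sum d (x, y, z) = 0"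
    unfolding curve_C_def power_sum_def by auto
  then show "power_sum d v = 0"
    by (cases v) (auto simp: proj_eq_iff power_sum_scale)
next
  assume "power_sum d v = 0"
  then show "proj v \<in> curve_C d"
    using assms by (cases v) (auto simp: curve_C_def power_sum_def)
qed

lemma power_sum_zero: "d \<ge> 1 \<Longrightarrow> power_sum d 0 = 0"
  by (simp add: power_sum_def zero_prod_def zero_power)

lemma preimage_curve_complement:
  assumes "d \<ge> 1"
  shows "{v. v \<noteq> 0 \<and> proj v \<in> topspace CP2_topology - curve_C d} = {v. power_sum d v \<noteq> 0}"
proof -
  have "proj v \<in> topspace CP2_topology - curve_C d \<longleftrightarrow> power_sum d v \<noteq> 0" if "v \<noteq> 0" for v
    using proj_in_curve_C_iff[OF assms that] that by (auto simp: topspace_CP2)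
  moreover have "v \<noteq> 0" if "power_sum d v \<noteq> 0" for v
    using power_sum_zero[OF assms] that by blast
  ultimately show ?thesis by blast
qed

text \<open>A quotient map restricted to the full preimage of an open set is again a quotient map;
  the preimage here is the cone where the power sum is nonzero.\<close>

lemma quotient_map_curve_complement:
  assumes "d \<ge> 1"
  shows "quotient_map (top_of_set {v. power_sum d v \<noteq> 0}) (curve_complement d) proj"
proof -
  let ?V = "topspace CP2_topology - curve_C d"
  have "open {v. power_sum d v \<noteq> 0}"
    unfolding power_sum_def case_prod_unfold by (intro open_Collect_neq continuous_intros)
  then have "openin CP2_topology ?V"
    unfolding openin_CP2_topology preimage_curve_complement[OF assms] by (auto simp: topspace_CP2)
  moreover have "{v \<in> topspace (top_of_set (UNIV - {0})). proj v \<in> ?V} = {v. power_sum d v \<noteq> 0}"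
    using preimage_curve_complement[OF assms] by auto
  ultimately have "quotient_map (subtopology (top_of_set (UNIV - {0})) {v. power_sum d v \<noteq> 0})
      (subtopology CP2_topology ?V) proj"
    using quotient_map_restriction[OF quotient_map_proj] by blast
  moreover have "(UNIV - {0}) \<inter> {v. power_sum d v \<noteq> 0} = {v. power_sum d v \<noteq> 0}"
    using power_sum_zero assms by auto
  ultimately show ?thesis by (simp add: subtopology_subtopology curve_complement_def)
qed

lemma topspace_curve_complement:
  "d \<ge> 1 \<Longrightarrow> topspace (curve_complement d) = proj ` {v. power_sum d v \<noteq> 0}"
  using quotient_imp_surjective_map[OF quotient_map_curve_complement] by simp

lemma proj_scale: "c \<noteq> 0 \<Longrightarrow> proj (c * x, c * y, c * z) = proj (x, y, z)"
  using proj_eq_iff[of x y z] by metis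

text \<open>Dividing by a \<open>d\<close>-th root of the power sum normalizes it to 1.\<close>

lemma curve_complement_representative:
  assumes "d \<ge> 1" "q \<in> topspace (curve_complement d)"
  shows "\<exists>p\<in>M d. proj p = q"
proof -
  obtain x y z where q: "q = proj (x, y, z)" "power_sum d (x, y, z) \<noteq> 0"
    using assms by (auto simp: topspace_curve_complement)
  define c where "c = power_sum d (x, y, z) powr (1 / of_nat d)"
  have c: "c ^ d = power_sum d (x, y, z)" using assms by (simp add: c_def powr_inverse_power)
  then have "c \<noteq> 0" using q assms by (auto simp: zero_power)
  have "power_sum d (inverse c * x, inverse c * y, inverse c * z) = 1"
    unfolding power_sum_scale using c q by (simp add: power_inverse)
  then have "(inverse c * x, inverse c * y, inverse c * z) \<in> M d" by (simp add: M_def power_sum_def)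
  moreover have "proj (inverse c * x, inverse c * y, inverse c * z) = q"
    using \<open>c \<noteq> 0\<close> q by (simp add: proj_scale)
  ultimately show ?thesis by blast
qed

lemma proj_in_curve_complement:
  "d \<ge> 1 \<Longrightarrow> power_sum d v \<noteq> 0 \<Longrightarrow> proj v \<in> topspace (curve_complement d)"
  by (auto simp: topspace_curve_complement)

section \<open>Endpoints and fixed points\<close>

lemma cone_retraction_0:
  assumes "d \<ge> 1" "power_sum d v \<noteq> 0" shows "cone_retraction d v 0 = v"
  using assms
  by (cases v) (auto simp: cone_retraction_def path_lift_def power_path_0
      intro!: root_lift_same[where s = "power_sum d v"])

lemma proj_cone_retraction_1:
  assumes "d \<ge> 1" "p \<in> M d"
  shows "proj (cone_retraction d p 1) \<in> K d"
proof -
  obtain x y z where p: "p = (x, y, z)" by (metis prod_cases3)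
  have s: "power_sum d p = 1" using assms by (simp add: p M_def power_sum_def)
  have "path_lift d p 1 u ^ d \<in> \<real>\<^sub>\<ge>\<^sub>0" for u
    using path_lift_power[OF assms(1), of p 1 u] s pos_mass_ge_1[of d p] power_path_1_nonneg
    by simp
  moreover have "proj (cone_retraction d p 1) \<in> topspace (curve_complement d)"
    using s assms by (intro proj_in_curve_complement) (simp_all add: power_sum_cone_retraction)
  ultimately show ?thesis
    using self_mem_proj[of "cone_retraction d p 1"] unfolding K_def cone_retraction_def p
    by auto
qed

lemma proj_eq_of_mem:
  assumes "v \<in> proj w" shows "proj w = proj v"
proof (cases w)
  case (fields x y z)
  then obtain c where "c \<noteq> 0" "v = (c * x, c * y, c * z)" using assms by (auto simp: proj_def)
  then show ?thesis using fields proj_scale by simp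
qed

text \<open>A representative with nonnegative powers has nonnegative normalized powers of sum 1. Its
  positive mass is therefore 1, its path of powers is constant, and the lift does not move
  it.\<close>

lemma K_representative:
  assumes "d \<ge> 1" "q \<in> K d"
  obtains v where "power_sum d v \<noteq> 0" "proj v = q" "\<And>t. cone_retraction d v t = v"
proof -
  obtain x y z where mem: "(x, y, z) \<in> q" and nonneg: "x ^ d \<in> \<real>\<^sub>\<ge>\<^sub>0" "y ^ d \<in> \<real>\<^sub>\<ge>\<^sub>0" "z ^ d \<in> \<real>\<^sub>\<ge>\<^sub>0"
    using assms by (auto simp: K_def)
  obtain w where w: "q = proj w" "power_sum d w \<noteq> 0"
    using assms by (auto simp: K_def topspace_curve_complement)
  define s where "s = power_sum d (x, y, z)"
  have s: "s \<in> \<real>\<^sub>\<ge>\<^sub>0" using nonneg by (simp add: s_def power_sum_def)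
  have q: "proj (x, y, z) = q" using mem w proj_eq_of_mem by metis
  then have "s \<noteq> 0"
    using w by (cases w) (auto simp: proj_eq_iff power_sum_scale s_def)
  have quot: "x ^ d / s \<in> \<real>\<^sub>\<ge>\<^sub>0" "y ^ d / s \<in> \<real>\<^sub>\<ge>\<^sub>0" "z ^ d / s \<in> \<real>\<^sub>\<ge>\<^sub>0"
    using nonneg s by simp_all
  have "Re (x ^ d / s) + Re (y ^ d / s) + Re (z ^ d / s) = 1"
    using normalized_powers_sum[of d x y z s] \<open>s \<noteq> 0\<close>
    by (metis plus_complex.sel(1) one_complex.sel(1) s_def)
  then have "pos_mass d (x, y, z) = 1"
    using quot by (simp add: pos_mass_def complex_nonneg_Reals_iff flip: s_def)
  then have "cone_retraction d (x, y, z) t = (x, y, z)" for t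
    using quot \<open>s \<noteq> 0\<close> assms
    by (simp add: cone_retraction_def path_lift_def power_path_nonneg flip: s_def)
      (simp add: root_lift_same[where s = s])
  then show ?thesis using that q \<open>s \<noteq> 0\<close> s_def by blast
qed

section \<open>Homotopy equivalence and descent to the quotient\<close>

lemma strong_deformation_retraction_imp_homotopy_equivalent:
  assumes "strong_deformation_retraction X A H"
  shows "X homotopy_equivalent_space subtopology X A"
proof (rule deformation_retract_imp_homotopy_equivalent_space)
  let ?r = "\<lambda>x. H (x, 1)"
  have A: "A \<subseteq> topspace X" and H: "continuous_map (prod_topology X (top_of_set {0..1})) X H"
    and ends: "\<And>x. x \<in> topspace X \<Longrightarrow> H (x, 0) = x" "\<And>x. x \<in> topspace X \<Longrightarrow> H (x, 1) \<in> A"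
    and stay: "\<And>a. a \<in> A \<Longrightarrow> H (a, 1) = a"
    using assms unfolding strong_deformation_retraction_def by auto
  have cr: "continuous_map X X ?r"
    using continuous_map_compose[OF _ H, of X "\<lambda>x. (x, 1)"]
    by (simp add: o_def continuous_map_pairedI)
  have "homotopic_with (\<lambda>x. True) X X id ?r"
    unfolding homotopic_with[of X "\<lambda>x. True", simplified]
  \<comment> \<open>\<open>homotopic_with\<close> expects the time as first component, hence the
    swap.\<close>
  proof (intro exI[of _ "H \<circ> (\<lambda>(t, x). (x, t))"] conjI)
    show "continuous_map (prod_topology (top_of_set {0..1}) X) X (H \<circ> (\<lambda>(t, x). (x, t)))"
      using homeomorphic_imp_continuous_map[OF homeomorphic_map_swap]
      by (rule continuous_map_compose[OF _ H])
  qed (use ends in auto)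
  then show "homotopic_with (\<lambda>x. True) X X ?r id" by (rule homotopic_with_symD)
  show "retraction_maps X (subtopology X A) ?r id"
    using cr A ends stay by (auto simp: retraction_maps_def continuous_map_in_subtopology)
qed

theorem theorem2p5:
  fixes d :: nat
  assumes "d \<ge> 1"
  shows
    "(\<forall>q \<in> topspace (curve_complement d). \<exists>p \<in> M d. proj p = q) \<and>
     (\<forall>p \<in> M d. \<forall>p' \<in> M d. proj p = proj p' \<longrightarrow>
        (\<forall>t \<in> {0..1}. proj (r_tilde d p t) = proj (r_tilde d p' t))) \<and>
     (\<exists>R. (\<forall>p \<in> M d. \<forall>t \<in> {0..1}. R (proj p, t) = proj (r_tilde d p t)) \<and>
          strong_deformation_retraction (curve_complement d) (K d) R) \<and>
     curve_complement d homotopy_equivalent_space subtopology (curve_complement d) (K d)"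
proof -
  let ?V = "{v. power_sum d v \<noteq> 0}" and ?I = "top_of_set {0..1::real}"
  let ?F = "\<lambda>(v, t). cone_retraction d v t"
  \<comment> \<open>The interval is compact Hausdorff, hence locally compact, so the product with
    its identity preserves quotient maps.\<close>
  have quotient: "quotient_map (prod_topology (top_of_set ?V) ?I)
      (prod_topology (curve_complement d) ?I) (\<lambda>(v, t). (proj v, t))"
    by (rule quotient_map_prod_left[OF _ _ quotient_map_curve_complement[OF assms]])
      (auto simp: Hausdorff_space_subtopology
        intro!: compact_imp_locally_compact_space compact_space_subtopology)
  have "continuous_map (prod_topology (top_of_set ?V) ?I) (top_of_set ?V) ?F"
    unfolding prod_topology_subtopology_eu continuous_map_in_subtopology continuous_map_iff_continuous
    using continuous_on_cone_retraction[OF assms] power_sum_cone_retraction[OF assms] by auto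
  then have F: "continuous_map (prod_topology (top_of_set ?V) ?I) (curve_complement d) (proj \<circ> ?F)"
    by (rule continuous_map_compose)
      (rule quotient_imp_continuous_map[OF quotient_map_curve_complement[OF assms]])
  \<comment> \<open>Points of one fibre differ by a scalar, which the homogeneous homotopy carries
    along and \<open>proj\<close> forgets.\<close>
  have F_cong: "(proj \<circ> ?F) a = (proj \<circ> ?F) b"
    if "(\<lambda>(v, t). (proj v, t)) a = (\<lambda>(v, t). (proj v, t)) b" for a b
  proof -
    obtain x y z x' y' z' t t' where ab: "a = ((x, y, z), t)" "b = ((x', y', z'), t')"
      by (metis prod_cases3 surj_pair)
    then have t: "t = t'" and "proj (x, y, z) = proj (x', y', z')" using that by auto
    from this(2) obtain c where "c \<noteq> 0" "(x', y', z') = (c * x, c * y, c * z)" by (auto simp: proj_eq_iff)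
    moreover obtain u v w where "cone_retraction d (x, y, z) t = (u, v, w)" by (metis prod_cases3)
    ultimately show ?thesis using cone_retraction_scale ab t by (simp add: proj_scale)
  qed
  obtain R where R: "continuous_map (prod_topology (curve_complement d) ?I) (curve_complement d) R"
    and RF: "\<And>a. a \<in> topspace (prod_topology (top_of_set ?V) ?I) \<Longrightarrow>
      R ((\<lambda>(v, t). (proj v, t)) a) = (proj \<circ> ?F) a"
  proof (rule quotient_map_lift_exists[OF quotient F])
    show "(proj \<circ> ?F) a = (proj \<circ> ?F) b"
      if "(\<lambda>(v, t). (proj v, t)) a = (\<lambda>(v, t). (proj v, t)) b" for a b
      using that by (rule F_cong)
  qed (rule that)
  have R_cone: "R (proj v, t) = proj (cone_retraction d v t)"
    if "power_sum d v \<noteq> 0" "t \<in> {0..1}" for v t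
    using RF[of "(v, t)"] that by simp
  have M: "power_sum d p = 1" if "p \<in> M d" for p
    using that by (auto simp: M_def power_sum_def)
  have R_tilde: "R (proj p, t) = proj (r_tilde d p t)" if "p \<in> M d" "t \<in> {0..1}" for p t
    using R_cone[of p t] M that assms by (simp add: r_tilde_eq_cone_retraction)
  have representative: "\<exists>p\<in>M d. proj p = q" if "q \<in> topspace (curve_complement d)" for q
    using curve_complement_representative assms that by blast
  have "strong_deformation_retraction (curve_complement d) (K d) R"
    unfolding strong_deformation_retraction_def
  proof (intro conjI ballI R)
    show "K d \<subseteq> topspace (curve_complement d)" by (auto simp: K_def)
    fix q assume "q \<in> topspace (curve_complement d)"
    then obtain p where "p \<in> M d" "proj p = q" using representative by blast
    then show "R (q, 0) = q" "R (q, 1) \<in> K d"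
      using R_cone[of p] M[of p] cone_retraction_0[OF assms, of p] proj_cone_retraction_1[OF assms]
      by auto
  next
    \<comment> \<open>A representative fixed by the homotopy on the cone is used; it need not lie in
      \<open>M d\<close>.\<close>
    fix q t assume "q \<in> K d" "t \<in> {0..1::real}"
    then obtain v where "power_sum d v \<noteq> 0" "proj v = q" "\<And>t. cone_retraction d v t = v"
      using K_representative[OF assms] by metis
    then show "R (q, t) = q" using R_cone \<open>t \<in> {0..1}\<close> by metis
  qed
  moreover from this have "curve_complement d homotopy_equivalent_space
      subtopology (curve_complement d) (K d)"
    by (rule strong_deformation_retraction_imp_homotopy_equivalent)
  \<comment> \<open>Both sides are the value of \<open>R\<close> at the same point, so independence
    of the representative is immediate.\<close>
  moreover have "proj (r_tilde d p t) = proj (r_tilde d p' t)"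
    if "p \<in> M d" "p' \<in> M d" "proj p = proj p'" "t \<in> {0..1}" for p p' t
    using R_tilde that by metis
  ultimately show ?thesis
    using R_tilde representative by (intro conjI exI[of _ R]) blast+
qed

end
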